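(* Let $G$ be the bounded domain whose boundary is the loop around $0$ of the lemniscate $\{z\in\mathbb{C}:|z(z+1)|=1/4\}$. 1) Let $f$ be a function holomorphic in $G$ and continuous in $\overline G\setminus\{-1/2\}$. Then, for any compact subset $K$ of $\overline G\setminus\{-1/2\}$, there exists a sequence of polynomials $\{P_n\}$ in $\mathbb{C}[z]$, $\deg P_n\le n$, such that $$\sup_{z\in K}|f(z)-(1+z)^nP_n(z)|\to 0\quad\text{as } n\to\infty.$$ 2) Let $f$ be a function holomorphic in $G$ and continuous in $\overline G$ with $f(-1/2)=0$. Then there exists a sequence of polynomials $\{P_n\}$ in $\mathbb{C}[z]$, $\deg P_n\le n$, such that $$\sup_{z\in\overline G}|f(z)-(1+z)^nP_n(z)|\to 0\quad\text{as } n\to\infty.$$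
   Context: The lemniscate $\{z\in\mathbb{C}:|z(z+1)|=1/4\}$ consists of two loops meeting at the point $-1/2$, one surrounding $0$ and the other surrounding $-1$. *)

theory Defs
  imports "HOL-Complex_Analysis.Complex_Analysis"
begin

definition lemniscate :: "complex set" where
  "lemniscate = {z. cmod (z * (z + 1)) = 1 / 4}"

text \<open>A Jordan curve contained in the lemniscate and surrounding the point \<open>w\<close>.  The lemniscate is a
  figure eight, so the only Jordan curves it contains are its two loops; for \<open>w = 0\<close> this
  predicate therefore singles out the loop around \<open>0\<close>, and for \<open>w = -1\<close> the other one.\<close>

definition lemniscate_loop_around :: "complex \<Rightarrow> complex set \<Rightarrow> bool" where
  "lemniscate_loop_around w \<Gamma> \<longleftrightarrow>
     (\<exists>\<gamma>. simple_path \<gamma> \<and> pathfinish \<gamma> = pathstart \<gamma> \<and> path_image \<gamma> = \<Gamma>) \<and>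
     \<Gamma> \<subseteq> lemniscate \<and> w \<in> inside \<Gamma>"

text \<open>The supremum over \<open>K\<close> of the modulus.  It is taken in the extended nonnegative reals,
  so that it is \<open>0\<close> for empty \<open>K\<close> and \<open>\<infinity>\<close> for an unbounded function.\<close>

definition sup_norm_on :: "complex set \<Rightarrow> (complex \<Rightarrow> complex) \<Rightarrow> ennreal" where
  "sup_norm_on K g = (SUP z\<in>K. ennreal (cmod (g z)))"

end

theory Submission
  imports Defs
begin

text \<open>The function \<open>w = z * (z + 1)\<close> maps the domain \<open>G\<close> conformally onto the disc of radius \<open>1/4\<close>, with
the node \<open>-1/2\<close> going to \<open>-1/4\<close> (\<open>domain_bounded_by_loop_eq_petal\<close> identifies \<open>G\<close> with the explicit set
\<open>petal\<close>). The whole approximation is carried out with polynomials in \<open>w\<close>, and it rests on two facts.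

The constant 1 is approximable. Let \<open>B\<close> be the Taylor polynomial of degree \<open>m\<close> of
$(1 + z)^{-(m+1)}$. Then $(1+z)^{m+1} B(z)$ equals 1/2 plus \<open>(1 + 2 * z) / 2\<close> times a partial sum of the
binomial series of $(1 - t)^{-1/2}$ with \<open>t = - 4 * w = 1 - (1 + 2 * z)\<^sup>2\<close>
(\<open>approx_one_eq\<close>). As the coefficients of that series decrease to 0, Abel summation
bounds the error, multiplied by \<open>1 + 2 * z\<close>, uniformly on the closure of \<open>G\<close>
(\<open>approx_one_error\<close>). Thus convergence can fail only at the node.

Polynomials in \<open>w\<close> cost no degree. Since \<open>w ^ k = z ^ k * (1 + z) ^ k\<close>, multiplying by
\<open>w ^ k\<close> raises the exponent of \<open>1 + z\<close> and the degree of the other factor equally, so the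
approximation of 1 extends to every polynomial in \<open>w\<close> (\<open>weighted_approx_composed_poly\<close>).

A function on the closure of \<open>G\<close>, seen in the coordinate \<open>w\<close>, is approximated by polynomials in
\<open>w\<close> by dilating the disc (\<open>petal_approx_composed_poly\<close>). Away from the node this settles the
first claim. For the second, \<open>f\<close> vanishes at the node, so the polynomial can be taken divisible by
\<open>w + 1/4 = (1 + 2 * z)\<^sup>2 / 4\<close> up to a small constant. This factor cancels the loss at the node. Its
degree 2 has to be made up for, which is done by approximating \<open>f z / (1 + z)\<close> in
place of \<open>f\<close>: the target \<open>(1 + z) * poly q w\<close> then contributes one unit to the exponent, and the
degree bound of \<open>B\<close>, one below the exponent, provides the other.\<close>

section \<open>Central binomial coefficients\<close>

text \<open>The probability of a tie after \<open>2 * n\<close> tosses of a fair coin. With this normalisation the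
coefficients of $(1 - t)^{-1/2}$ at \<open>t = 0\<close> are exactly these numbers.\<close>

definition central_prob :: "nat \<Rightarrow> real" where
  "central_prob n = real ((2 * n) choose n) / 4 ^ n"

lemma choose_central_Suc: "(2 * Suc n) choose Suc n = 2 * ((2 * n + 1) choose Suc n)"
proof -
  have "(2 * Suc n) choose Suc n = ((2 * n + 1) choose n) + ((2 * n + 1) choose Suc n)"
    by simp
  also have "(2 * n + 1) choose n = (2 * n + 1) choose Suc n"
    using binomial_symmetric[of n "2 * n + 1"] by simp
  finally show ?thesis by simp
qed

lemma Suc_times_choose_central:
  "Suc n * ((2 * Suc n) choose Suc n) = 2 * (2 * n + 1) * ((2 * n) choose n)"
proof -
  have "Suc n * ((2 * n + 1) choose Suc n) = (2 * n + 1) * ((2 * n) choose n)"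
    using Suc_times_binomial_eq[of "2 * n" n] by simp
  then show ?thesis unfolding choose_central_Suc by (simp add: algebra_simps)
qed

lemma central_prob_Suc: "central_prob (Suc n) = central_prob n * (2 * real n + 1) / (2 * real n + 2)"
proof -
  have "real (Suc n * ((2 * Suc n) choose Suc n)) = real (2 * (2 * n + 1) * ((2 * n) choose n))"
    by (simp only: Suc_times_choose_central)
  moreover define c where "c = real ((2 * Suc n) choose Suc n)"
  moreover define d where "d = real ((2 * n) choose n)"
  ultimately have "(real n + 1) * c = 2 * (2 * real n + 1) * d"
    by (simp only: of_nat_mult of_nat_add of_nat_Suc of_nat_numeral of_nat_1) (simp add: algebra_simps)
  then have "c = 2 * (2 * real n + 1) * d / (real n + 1)"
    by (simp add: field_simps)
  also have "\<dots> = 4 * (d * (2 * real n + 1) / (2 * real n + 2))"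
    by (simp add: divide_simps) (simp add: algebra_simps)
  finally show ?thesis
    unfolding central_prob_def c_def[symmetric] d_def[symmetric] by simp
qed

lemma central_prob_nonneg: "0 \<le> central_prob n"
  by (simp add: central_prob_def)

lemma central_prob_Suc_le: "central_prob (Suc n) \<le> central_prob n"
  unfolding central_prob_Suc using central_prob_nonneg[of n] by (simp add: divide_simps mult_left_mono)

text \<open>The factor \<open>2 * n + 1\<close> is what makes the induction close: one step multiplies the left-hand side by
\<open>(2 * n + 1) * (2 * n + 3) / (2 * n + 2)\<^sup>2\<close>, which is below 1.\<close>

lemma central_prob_sq_bound: "(central_prob n)\<^sup>2 * (2 * real n + 1) \<le> 1"
proof (induction n)
  case 0
  show ?case by (simp add: central_prob_def)
next
  case (Suc n)
  have "(central_prob (Suc n))\<^sup>2 * (2 * real (Suc n) + 1)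
      = ((central_prob n)\<^sup>2 * (2 * real n + 1))
          * ((2 * real n + 1) * (2 * real n + 3) / (2 * real n + 2)\<^sup>2)"
    unfolding central_prob_Suc by (simp add: power2_eq_square field_simps)
  also have "\<dots> \<le> 1 * 1"
  proof (intro mult_mono)
    show "(2 * real n + 1) * (2 * real n + 3) / (2 * real n + 2)\<^sup>2 \<le> 1"
      by (subst divide_le_eq_1_pos) (auto simp: power2_eq_square algebra_simps add_pos_nonneg)
  qed (use Suc in auto)
  finally show ?case by simp
qed

lemma central_prob_tendsto_0: "central_prob \<longlonglongrightarrow> 0"
proof -
  have "(\<lambda>n. (central_prob n)\<^sup>2) \<longlonglongrightarrow> 0"
  proof (rule tendsto_sandwich)
    show "(\<lambda>n. 0::real) \<longlonglongrightarrow> 0" "(\<lambda>n. 1 / real (Suc n)) \<longlonglongrightarrow> 0"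
      using LIMSEQ_Suc[OF lim_1_over_n] by auto
    have "(central_prob n)\<^sup>2 \<le> 1 / real (Suc n)" for n
    proof -
      have "(central_prob n)\<^sup>2 * real (Suc n) \<le> (central_prob n)\<^sup>2 * (2 * real n + 1)"
        by (intro mult_left_mono) auto
      also have "\<dots> \<le> 1" by (rule central_prob_sq_bound)
      finally show ?thesis by (simp add: field_simps)
    qed
    then show "\<forall>\<^sub>F n in sequentially. (central_prob n)\<^sup>2 \<le> 1 / real (Suc n)" by simp
  qed simp
  then show ?thesis by simp
qed

text \<open>Multiplying by \<open>1 - t\<close> turns the sum into one of differences of consecutive coefficients, which
telescope because the coefficients decrease. The bound is uniform up to \<open>norm t = 1\<close>, where the
series itself may fail to converge absolutely; it will control the approximation error up to the
boundary of the domain.\<close>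

lemma norm_Abel_sum_le:
  fixes t :: complex and a :: "nat \<Rightarrow> real"
  assumes "norm t \<le> 1" and nn: "\<And>k. 0 \<le> a k" and dec: "\<And>k. a (Suc k) \<le> a k"
  shows "norm ((1 - t) * (\<Sum>k=n..<n+j. a k * t ^ k)) \<le> 2 * a n"
proof (cases j)
  case 0
  then show ?thesis using nn by simp
next
  case (Suc i)
  have pw: "norm (t ^ k) \<le> 1" for k
    using assms(1) by (simp add: norm_power power_le_one)
  \<comment> \<open>The boundary term of the summation by parts is kept on the left, so that each induction step
    adds only a difference of consecutive coefficients.\<close>
  have "norm ((1 - t) * (\<Sum>k=n..<n + Suc i. a k * t ^ k) + a (n + i) * t ^ (n + Suc i))
      \<le> 2 * a n - a (n + i)"
  proof (induction i)
    case 0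
    have "norm ((1 - t) * (\<Sum>k=n..<n + Suc 0. a k * t ^ k) + a (n + 0) * t ^ (n + Suc 0))
        = a n * norm (t ^ n)"
      using nn[of n] by (simp add: algebra_simps norm_mult)
    also have "\<dots> \<le> 2 * a n - a (n + 0)"
      using mult_left_mono[OF pw[of n] nn[of n]] by simp
    finally show ?case .
  next
    case (Suc i)
    have eq: "(1 - t) * (\<Sum>k=n..<n + Suc (Suc i). a k * t ^ k)
            + a (n + Suc i) * t ^ (n + Suc (Suc i))
        = ((1 - t) * (\<Sum>k=n..<n + Suc i. a k * t ^ k) + a (n + i) * t ^ (n + Suc i))
          - of_real (a (n + i) - a (n + Suc i)) * t ^ (n + Suc i)"
      by (simp add: algebra_simps)
    have "norm (of_real (a (n + i) - a (n + Suc i)) * t ^ (n + Suc i))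
        = (a (n + i) - a (n + Suc i)) * norm (t ^ (n + Suc i))"
      using dec[of "n + i"] by (simp only: norm_mult norm_of_real) simp
    also have "\<dots> \<le> a (n + i) - a (n + Suc i)"
      using mult_left_mono[OF pw[of "n + Suc i"], of "a (n + i) - a (n + Suc i)"] dec[of "n + i"]
      by simp
    finally show ?case unfolding eq using Suc by (intro order_trans[OF norm_triangle_ineq4]) linarith
  qed
  moreover have "norm (of_real (a (n + i)) * t ^ (n + Suc i)) \<le> a (n + i)"
    using mult_left_mono[OF pw[of "n + Suc i"] nn[of "n + i"]] nn[of "n + i"]
    by (simp add: norm_mult)
  ultimately show ?thesis
    unfolding Suc using norm_triangle_ineq4[of
      "(1 - t) * (\<Sum>k=n..<n + Suc i. a k * t ^ k) + a (n + i) * t ^ (n + Suc i)"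
      "of_real (a (n + i)) * t ^ (n + Suc i)"] by simp
qed

text \<open>The binomial series for $(1 - t)^{-1/2}$ at \<open>t = 1 - s\<^sup>2\<close>; the condition on \<open>Re s\<close> says that \<open>s\<close> is
the principal square root of \<open>1 - t\<close>.\<close>

lemma sums_central_binomial:
  fixes s :: complex
  assumes "0 < Re s" and "norm (1 - s\<^sup>2) < 1"
  shows "(\<lambda>k. central_prob k * (1 - s\<^sup>2) ^ k) sums inverse s"
proof -
  have coeff: "((-1/2) gchoose k) * (-1) ^ k = complex_of_real (central_prob k)" for k
  proof (induction k)
    case 0
    show ?case by (simp add: central_prob_def)
  next
    case (Suc k)
    have "((-1/2::complex) gchoose Suc k) = ((-1/2) gchoose k) * (-1/2 - of_nat k) / of_nat (Suc k)"
      using gbinomial_mult_1'[of "-1/2::complex" k] by (simp add: field_simps del: of_nat_Suc)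
    then have "((-1/2::complex) gchoose Suc k) * (-1) ^ Suc k
        = (((-1/2) gchoose k) * (-1) ^ k) * ((of_nat k + 1/2) / of_nat (Suc k))"
      by (simp add: field_simps)
    also have "\<dots> = complex_of_real (central_prob (Suc k))"
      unfolding Suc central_prob_Suc by (simp add: field_simps)
    finally show ?case .
  qed
  have "s\<^sup>2 powr (-1/2) = inverse s"
  proof -
    have "s \<noteq> 0" using assms(1) by auto
    have "csqrt (s\<^sup>2) = s" using assms(1) by (intro csqrt_square) auto
    then have "s\<^sup>2 powr (1/2) = s" by (simp add: csqrt_conv_powr)
    then show ?thesis by (metis powr_minus minus_divide_left)
  qed
  then have "(\<lambda>k. ((-1/2) gchoose k) * (s\<^sup>2 - 1) ^ k) sums inverse s"
    using gen_binomial_complex[of "s\<^sup>2 - 1" "-1/2"] assms(2) by (simp add: norm_minus_commute)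
  moreover have "((-1/2) gchoose k) * (s\<^sup>2 - 1) ^ k = central_prob k * (1 - s\<^sup>2) ^ k" for k
    unfolding coeff[symmetric] mult.assoc power_mult_distrib[symmetric] by simp
  ultimately show ?thesis by simp
qed

section \<open>Weighted polynomials tending to 1\<close>

text \<open>The Taylor polynomial of degree \<open>m\<close> at 0 of $(1 + z)^{-(m+1)}$.\<close>

definition taylor_inverse_power :: "nat \<Rightarrow> complex poly" where
  "taylor_inverse_power m = (\<Sum>k\<le>m. monom (of_nat ((m + k) choose k) * (-1) ^ k) k)"

lemma degree_taylor_inverse_power: "degree (taylor_inverse_power m) \<le> m"
  unfolding taylor_inverse_power_def by (intro degree_sum_le) (auto intro: order_trans[OF degree_monom_le])

lemma poly_taylor_inverse_power: "poly (taylor_inverse_power m) z = (\<Sum>k\<le>m. of_nat ((m + k) choose k) * (- z) ^ k)"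
  unfolding taylor_inverse_power_def poly_sum poly_monom mult.assoc power_mult_distrib[symmetric] by simp

text \<open>Multiplication by \<open>1 + z\<close> turns the coefficients of index \<open>m + 1\<close> into those of index \<open>m\<close> by Pascal's
rule; what is left over are the two terms of highest degree, and these combine because
\<open>(2 * m + 1) choose (m + 1)\<close> is half of the next central binomial coefficient.\<close>

lemma taylor_inverse_power_Suc:
  "(1 + z) * poly (taylor_inverse_power (Suc m)) z
     = poly (taylor_inverse_power m) z + (1 + 2 * z) / 2 * of_nat ((2 * Suc m) choose Suc m) * (- z) ^ Suc m"
proof -
  define x where "x = - z"
  define b where "b k = (of_nat ((Suc m + k) choose k) :: complex)" for k
  define c where "c k = (of_nat ((m + k) choose k) :: complex)" for k
  have pascal: "b (Suc k) = b k + c (Suc k)" for k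
    by (simp add: b_def c_def)
  have tele: "(1 - x) * (\<Sum>k\<le>j. b k * x ^ k) = (\<Sum>k\<le>j. c k * x ^ k) - b j * x ^ Suc j" for j
  proof (induction j)
    case 0
    show ?case by (simp add: b_def c_def)
  next
    case (Suc j)
    then show ?case by (simp add: distrib_left pascal) (simp add: algebra_simps)
  qed
  have idx: "2 * Suc m = Suc m + Suc m" "2 * m + 1 = m + Suc m" by simp_all
  have "c (Suc m) = of_nat ((2 * Suc m) choose Suc m) / 2"
    unfolding choose_central_Suc idx(2) c_def by (simp only: of_nat_mult of_nat_numeral) simp
  moreover have "b (Suc m) = of_nat ((2 * Suc m) choose Suc m)"
    unfolding b_def idx(1) by (rule refl)
  ultimately have central: "b (Suc m) = of_nat ((2 * Suc m) choose Suc m)"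
    "c (Suc m) = b (Suc m) / 2" by simp_all
  have "(1 - x) * (\<Sum>k\<le>Suc m. b k * x ^ k)
      = (\<Sum>k\<le>m. c k * x ^ k) + c (Suc m) * x ^ Suc m - b (Suc m) * x ^ Suc (Suc m)"
    unfolding tele by simp
  also have "\<dots> = (\<Sum>k\<le>m. c k * x ^ k) + (1 - 2 * x) / 2 * b (Suc m) * x ^ Suc m"
    unfolding central(2) by (simp add: field_simps)
  finally show ?thesis
    unfolding central(1) by (simp add: poly_taylor_inverse_power x_def b_def c_def)
qed

definition approx_one :: "nat \<Rightarrow> complex \<Rightarrow> complex" where
  "approx_one m z = (1 + z) ^ Suc m * poly (taylor_inverse_power m) z"

text \<open>This is what identifies the limit: the sum is a partial sum of the binomial series of
$((1 + 2 z)^2)^{-1/2}$, which is the reciprocal of \<open>1 + 2 * z\<close> when \<open>Re z > -1/2\<close>, so there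
\<open>approx_one m z\<close> tends to \<open>1/2 + 1/2\<close>. The variable of the series is
\<open>1 - (1 + 2 * z)\<^sup>2 = - 4 * z * (z + 1)\<close>, and its modulus equals 1 exactly on the lemniscate.\<close>

lemma approx_one_eq:
  fixes z :: complex
  shows
  "approx_one m z = 1 / 2 + (1 + 2 * z) / 2 * (\<Sum>k\<le>m. central_prob k * (1 - (1 + 2 * z)\<^sup>2) ^ k)"
proof (induction m)
  case 0
  show ?case by (simp add: approx_one_def taylor_inverse_power_def central_prob_def field_simps)
next
  case (Suc m)
  have quad: "1 - (1 + 2 * z)\<^sup>2 = 4 * ((1 + z) * (- z))"
    by (simp add: power2_eq_square algebra_simps)
  have "approx_one (Suc m) z = (1 + z) ^ Suc m * ((1 + z) * poly (taylor_inverse_power (Suc m)) z)"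
    by (simp add: approx_one_def mult_ac)
  also have "\<dots> = approx_one m z + (1 + 2 * z) / 2
      * (of_nat ((2 * Suc m) choose Suc m) * ((1 + z) * (- z)) ^ Suc m)"
    unfolding taylor_inverse_power_Suc approx_one_def power_mult_distrib by (simp only: distrib_left mult_ac)
  also have "of_nat ((2 * Suc m) choose Suc m) * ((1 + z) * (- z)) ^ Suc m
      = central_prob (Suc m) * (1 - (1 + 2 * z)\<^sup>2) ^ Suc m"
    unfolding central_prob_def quad power_mult_distrib by simp
  finally show ?case unfolding Suc by (simp add: distrib_left)
qed

section \<open>The domain bounded by the loop\<close>

text \<open>The explicit form of the domain bounded by the loop around 0.\<close>

definition petal :: "complex set" where
  "petal = {z. -1/2 < Re z \<and> cmod (z * (z + 1)) < 1/4}"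

text \<open>The inverse branch of \<open>z \<mapsto> z * (z + 1)\<close> that fixes 0. It maps the disc of radius \<open>1/4\<close>
conformally onto the petal.\<close>

definition petal_param :: "complex \<Rightarrow> complex" where
  "petal_param w = (csqrt (1 + 4 * w) - 1) / 2"

lemma closure_petal_subset: "closure petal \<subseteq> {z. -1/2 \<le> Re z \<and> cmod (z * (z + 1)) \<le> 1/4}"
proof (rule closure_minimal)
  show "closed {z. -1/2 \<le> Re z \<and> cmod (z * (z + 1)) \<le> 1/4}"
    by (intro closed_Collect_conj closed_Collect_le continuous_intros)
qed (auto simp: petal_def)

lemma closure_petalD:
  assumes "z \<in> closure petal"
  shows "-1/2 \<le> Re z" "cmod (z * (z + 1)) \<le> 1/4"
    "1/2 \<le> cmod (1 + z)" "cmod (1 + z) \<le> 3/2" "cmod (1 + 2 * z) \<le> 2"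
proof -
  show re: "-1/2 \<le> Re z" and w: "cmod (z * (z + 1)) \<le> 1/4"
    using closure_petal_subset assms by auto
  show lower: "1/2 \<le> cmod (1 + z)"
    using complex_Re_le_cmod[of "1 + z"] re by simp
  have "cmod z * (1/2) \<le> cmod z * cmod (1 + z)"
    using lower by (intro mult_left_mono) auto
  also have "\<dots> \<le> 1/4" using w by (simp add: norm_mult add.commute)
  finally have "cmod z \<le> 1/2" by simp
  then show "cmod (1 + z) \<le> 3/2" "cmod (1 + 2 * z) \<le> 2"
    using norm_triangle_ineq[of 1 z] norm_triangle_ineq[of 1 "2 * z"]
    by (simp_all add: norm_mult)
qed

lemma norm_quadratic_on_axis:
  assumes "Re z = -1/2"
  shows "cmod (z * (z + 1)) = 1/4 + (Im z)\<^sup>2"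
proof -
  have "z * (z + 1) = - of_real (1/4 + (Im z)\<^sup>2)"
    by (simp add: complex_eq_iff assms power2_eq_square)
  then have "cmod (z * (z + 1)) = \<bar>1/4 + (Im z)\<^sup>2\<bar>"
    by (simp only: norm_minus_cancel norm_of_real)
  then show ?thesis by simp
qed

lemma Re_pos_of_small:
  fixes w :: complex
  shows "cmod w \<le> 1/4 \<Longrightarrow> 0 \<le> Re (1 + 4 * w)"
    "cmod w < 1/4 \<Longrightarrow> 0 < Re (1 + 4 * w)"
  using abs_Re_le_cmod[of w] by auto

lemma petal_param_quadratic: "petal_param w * (petal_param w + 1) = w"
proof -
  have "petal_param w * (petal_param w + 1) = ((csqrt (1 + 4 * w))\<^sup>2 - 1) / 4"
    unfolding petal_param_def by (simp add: power2_eq_square field_simps)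
  then show ?thesis by (simp del: csqrt_power_even)
qed

lemma petal_param_inverse:
  assumes "z \<in> closure petal"
  shows "petal_param (z * (z + 1)) = z"
proof -
  have "0 < Re (1 + 2 * z) \<or> Re (1 + 2 * z) = 0 \<and> 0 \<le> Im (1 + 2 * z)"
  proof (cases "Re z = -1/2")
    case True
    then have "Im z = 0" using norm_quadratic_on_axis[OF True] closure_petalD(2)[OF assms] by simp
    then show ?thesis using True by simp
  qed (use closure_petalD(1)[OF assms] in auto)
  then have "csqrt ((1 + 2 * z)\<^sup>2) = 1 + 2 * z" by (rule csqrt_square)
  moreover have "1 + 4 * (z * (z + 1)) = (1 + 2 * z)\<^sup>2"
    by (simp add: power2_eq_square algebra_simps)
  ultimately show ?thesis by (simp add: petal_param_def)
qed

lemma petal_param_in_petal: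
  assumes "cmod w < 1/4"
  shows "petal_param w \<in> petal"
proof -
  define s where "s = csqrt (1 + 4 * w)"
  have "0 < Re (s\<^sup>2)" unfolding s_def power2_csqrt by (rule Re_pos_of_small(2)[OF assms])
  then have "Re s \<noteq> 0" by (auto simp: power2_eq_square)
  then have "0 < Re (csqrt (1 + 4 * w))"
    using csqrt_principal[of "1 + 4 * w"] by (auto simp: s_def)
  then show ?thesis
    using assms petal_param_quadratic[of w] by (simp add: petal_def petal_param_def)
qed

lemma petal_param_image: "petal_param ` ball 0 (1/4) = petal"
proof (rule set_eqI, rule iffI)
  fix z assume "z \<in> petal"
  then have "petal_param (z * (z + 1)) = z" "z * (z + 1) \<in> ball 0 (1/4)"
    using petal_param_inverse[of z] closure_subset[of petal] by (auto simp: petal_def)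
  then show "z \<in> petal_param ` ball 0 (1/4)" by (metis imageI)
qed (auto intro: petal_param_in_petal)

lemma petal_param_holomorphic: "petal_param holomorphic_on ball 0 (1/4)"
proof -
  have "1 + 4 * w \<notin> \<real>\<^sub>\<le>\<^sub>0" if "w \<in> ball 0 (1/4)" for w :: complex
    using Re_pos_of_small(2)[of w] that by (auto simp: complex_nonpos_Reals_iff)
  then show ?thesis unfolding petal_param_def by (intro holomorphic_intros) auto
qed

text \<open>The principal root is discontinuous along the negative axis but not at its end point 0, and the
closed right half-plane meets that slit only there.\<close>

lemma continuous_on_csqrt_halfplane: "continuous_on {w. 0 \<le> Re w} csqrt"
  unfolding continuous_on_eq_continuous_within
proof
  fix x assume x: "x \<in> {w. 0 \<le> Re w}"
  show "continuous (at x within {w. 0 \<le> Re w}) csqrt"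
  proof (cases "x = 0")
    case True
    have "((\<lambda>w. sqrt (cmod w)) \<longlongrightarrow> sqrt (cmod 0)) (at 0 within {w. 0 \<le> Re w})"
      by (intro tendsto_intros)
    then have "(csqrt \<longlongrightarrow> 0) (at 0 within {w. 0 \<le> Re w})"
      by (subst tendsto_norm_zero_iff[symmetric]) (simp add: norm_csqrt)
    then show ?thesis by (simp add: True continuous_within)
  next
    case False
    then have "x \<notin> \<real>\<^sub>\<le>\<^sub>0" using x by (auto simp: complex_nonpos_Reals_iff complex_eq_iff)
    then show ?thesis by (rule continuous_within_csqrt)
  qed
qed

lemma petal_param_continuous: "continuous_on (cball 0 (1/4)) petal_param"
  unfolding petal_param_def
  by (intro continuous_intros continuous_on_compose2[OF continuous_on_csqrt_halfplane])
     (use Re_pos_of_small(1) in auto)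

lemma petal_param_in_closure:
  assumes "w \<in> cball 0 (1/4)"
  shows "petal_param w \<in> closure petal"
proof -
  have "petal_param ` closure (ball 0 (1/4)) \<subseteq> closure (petal_param ` ball 0 (1/4))"
    using petal_param_continuous by (intro continuous_image_closure_subset) auto
  then show ?thesis using assms unfolding petal_param_image by auto
qed

lemma petal_param_eq_node_iff: "petal_param w = -1/2 \<longleftrightarrow> w = -1/4"
  by (auto simp: petal_param_def add_eq_0_iff field_simps)

text \<open>By the Jordan curve theorem a bounded connected open set with frontier \<open>\<Gamma>\<close> contains the whole inside
of \<open>\<Gamma>\<close>, for otherwise it would contain the outside, which is unbounded; in particular it contains 0.
The maximum principle for \<open>z * (z + 1)\<close> then puts it into the open lemniscate region. On the line
\<open>Re z = -1/2\<close> the modulus of \<open>z * (z + 1)\<close> is at least \<open>1/4\<close>, so a connected subset of that region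
containing 0 stays to the right of the line. Conversely the petal is connected and does not meet the
lemniscate, so it cannot leave the set.\<close>

lemma domain_bounded_by_loop_eq_petal:
  assumes loop: "lemniscate_loop_around 0 \<Gamma>"
    and G: "open G" "connected G" "bounded G" "frontier G = \<Gamma>"
  shows "G = petal"
proof -
  obtain \<gamma> where \<gamma>: "simple_path \<gamma>" "pathfinish \<gamma> = pathstart \<gamma>" "path_image \<gamma> = \<Gamma>"
    and sub: "\<Gamma> \<subseteq> lemniscate" and zero: "0 \<in> inside \<Gamma>"
    using loop unfolding lemniscate_loop_around_def by blast
  have J: "connected (inside \<Gamma>)" "connected (outside \<Gamma>)" "\<not> bounded (outside \<Gamma>)"
    using Jordan_inside_outside[OF \<gamma>(1,2)] unfolding \<gamma>(3) by auto
  have disj: "G \<inter> \<Gamma> = {}" using G(1,4) by (auto simp: frontier_def interior_open)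
  have "\<Gamma> \<noteq> {}" using \<gamma>(3) by auto
  then have "G \<noteq> {}" using G(4) by auto
  have "G \<inter> inside \<Gamma> \<noteq> {}"
  proof
    assume "G \<inter> inside \<Gamma> = {}"
    then have "G \<subseteq> outside \<Gamma>" using disj inside_Un_outside[of \<Gamma>] by blast
    then have "outside \<Gamma> \<inter> G \<noteq> {}" using \<open>G \<noteq> {}\<close> by blast
    then have "outside \<Gamma> \<subseteq> G"
      using connected_Int_frontier[OF J(2), of G] G(4) outside_no_overlap[of \<Gamma>] by blast
    then show False using J(3) G(3) bounded_subset by blast
  qed
  then have "inside \<Gamma> \<subseteq> G"
    using connected_Int_frontier[OF J(1), of G] G(4) inside_no_overlap[of \<Gamma>] by blast
  then have "0 \<in> G" using zero by blast
  define h :: "complex \<Rightarrow> complex" where "h z = z * (z + 1)" for z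
  have holo: "h holomorphic_on A" for A unfolding h_def by (intro holomorphic_intros)
  have le: "cmod (h z) \<le> 1/4" if "z \<in> G" for z
  proof (rule maximum_modulus_frontier[of h G])
    show "continuous_on (closure G) h" unfolding h_def by (intro continuous_intros)
    show "cmod (h z) \<le> 1/4" if "z \<in> frontier G" for z
      using that sub G(4) by (auto simp: lemniscate_def h_def)
  qed (use that holo G in auto)
  have less: "cmod (h z) < 1/4" if "z \<in> G" for z
  proof (rule ccontr)
    assume "\<not> cmod (h z) < 1/4"
    then have eq: "cmod (h z) = 1/4" using le[OF that] by simp
    have "h constant_on G"
      by (rule maximum_modulus_principle[OF holo G(1,2,1) subset_refl that]) (simp only: eq le)
    then have "h z = h 0" using that \<open>0 \<in> G\<close> by (auto simp: constant_on_def)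
    moreover have "h 0 = 0" by (simp add: h_def)
    ultimately show False using eq by simp
  qed
  have off_axis: "Re z \<noteq> -1/2" if "z \<in> G" for z
  proof
    assume "Re z = -1/2"
    then show False using less[OF that] norm_quadratic_on_axis[of z] by (simp add: h_def)
  qed
  have "-1/2 < Re z" if "z \<in> G" for z
  proof (rule ccontr)
    assume "\<not> -1/2 < Re z"
    moreover have "connected (Re ` G)" 
      using G(2) by (intro connected_continuous_image continuous_intros)
    moreover have "Re z \<in> Re ` G" "0 \<in> Re ` G" using that \<open>0 \<in> G\<close> by (auto intro: rev_image_eqI)
    ultimately have "-1/2 \<in> Re ` G" using connectedD_interval[of "Re ` G" "Re z" 0 "-1/2"] by simp
    then show False using off_axis by force
  qed
  then have "G \<subseteq> petal" using less by (auto simp: petal_def h_def)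
  moreover have "petal \<subseteq> G"
  proof -
    have "connected petal"
      unfolding petal_param_image[symmetric]
      by (intro connected_continuous_image continuous_on_subset[OF petal_param_continuous]) auto
    moreover have "petal \<inter> G \<noteq> {}" using \<open>G \<subseteq> petal\<close> \<open>0 \<in> G\<close> by blast
    moreover have "petal \<inter> frontier G = {}"
      using sub G(4) by (auto simp: petal_def lemniscate_def)
    ultimately show ?thesis using connected_Int_frontier[of petal G] by blast
  qed
  ultimately show ?thesis by blast
qed

section \<open>The approximation error up to the boundary\<close>

text \<open>Inside the petal the error is a tail of the binomial series of $((1 + 2 z)^2)^{-1/2}$. The factor
\<open>1 + 2 * z\<close> supplies the \<open>1 - t\<close> that Abel summation asks for, and the resulting bound
passes to the closure by continuity. At the node \<open>z = -1/2\<close> the value of \<open>approx_one m\<close> is \<open>1/2\<close>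
for every \<open>m\<close>, so without that factor the error would not tend to 0 there.\<close>

lemma approx_one_error:
  assumes "z \<in> closure petal"
  shows "cmod ((1 + 2 * z) * (1 - approx_one m z)) \<le> central_prob (Suc m)"
proof (rule continuous_on_closure_norm_le[OF _ _ assms])
  show "continuous_on (closure petal) (\<lambda>z. (1 + 2 * z) * (1 - approx_one m z))"
    unfolding approx_one_def by (intro continuous_intros)
  show "\<forall>z\<in>petal. cmod ((1 + 2 * z) * (1 - approx_one m z)) \<le> central_prob (Suc m)"
  proof
    fix z assume z: "z \<in> petal"
    define s where "s = 1 + 2 * z"
    define t where "t = 1 - s\<^sup>2"
    define a where "a k = complex_of_real (central_prob k) * t ^ k" for k
    have "t = - 4 * (z * (z + 1))"
      by (simp add: t_def s_def power2_eq_square algebra_simps)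
    then have "cmod t = 4 * cmod (z * (z + 1))" by (simp add: norm_mult)
    then have t: "cmod t < 1" using z by (simp add: petal_def)
    have s: "0 < Re s" "s \<noteq> 0" using z by (auto simp: petal_def s_def complex_eq_iff)
    have "a sums inverse s"
      unfolding a_def t_def using s(1) t by (intro sums_central_binomial) (auto simp: t_def)
    then have "(\<lambda>i. a (i + Suc m)) sums (inverse s - (\<Sum>k<Suc m. a k))"
      by (rule sums_split_initial_segment)
    then have "(\<lambda>j. (1 - t) * (\<Sum>i<j. a (i + Suc m)))
        \<longlonglongrightarrow> (1 - t) * (inverse s - (\<Sum>k<Suc m. a k))"
      unfolding sums_def by (rule tendsto_mult_left)
    moreover have "cmod ((1 - t) * (\<Sum>i<j. a (i + Suc m))) \<le> 2 * central_prob (Suc m)" for j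
    proof -
      have "(\<Sum>i<j. a (i + Suc m)) = (\<Sum>k=Suc m..<Suc m + j. a k)"
        using sum.shift_bounds_nat_ivl[of a 0 "Suc m" j] by (simp add: lessThan_atLeast0 add.commute)
      then show ?thesis
        unfolding a_def using norm_Abel_sum_le[of t central_prob "Suc m" j] t central_prob_nonneg central_prob_Suc_le by simp
    qed
    ultimately have bound: "cmod ((1 - t) * (inverse s - (\<Sum>k<Suc m. a k))) \<le> 2 * central_prob (Suc m)"
      by (intro Lim_norm_ubound[OF _ _ always_eventually]) auto
    have "s * (1 - approx_one m z) = (1 - t) * (inverse s - (\<Sum>k<Suc m. a k)) / 2"
    proof -
      have "approx_one m z = 1/2 + s / 2 * (\<Sum>k<Suc m. a k)"
        unfolding approx_one_eq lessThan_Suc_atMost a_def t_def s_def ..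
      then show ?thesis using s(2) by (simp add: t_def field_simps power2_eq_square)
    qed
    then have "cmod (s * (1 - approx_one m z))
        = cmod ((1 - t) * (inverse s - (\<Sum>k<Suc m. a k))) / 2"
      by (simp only: norm_divide) simp
    then show "cmod ((1 + 2 * z) * (1 - approx_one m z)) \<le> central_prob (Suc m)"
      using bound by (simp only: s_def)
  qed
qed

text \<open>The monomials in \<open>w = z * (z + 1)\<close> carry powers of \<open>1 + z\<close> themselves: \<open>w ^ k\<close> times
\<open>approx_one m\<close> is \<open>(1 + z) ^ (m + 1 + k)\<close> times a polynomial of degree at most \<open>m + k\<close>, so a factor
\<open>w ^ k\<close> adds the same number to the exponent and to the degree bound. The extra factor \<open>1 + z\<close> in
the target raises the exponent once more. With \<open>m = n - 2 - k\<close> the exponent is \<open>n\<close> for all \<open>k\<close>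
together, and the degree bound is \<open>n - 2\<close>; the difference of 2 leaves room for multiplying by
\<open>(1 + 2 * z)\<^sup>2\<close>.\<close>

lemma weighted_approx_composed_poly:
  assumes "0 < e"
  shows "\<forall>\<^sub>F n in sequentially. \<exists>V. degree V \<le> n - 2 \<and> (\<forall>z\<in>closure petal.
    cmod ((1 + 2 * z) * ((1 + z) * poly q (z * (z + 1)) - (1 + z) ^ n * poly V z)) \<le> e)"
proof -
  define D where "D = degree q"
  define V where "V n = (\<Sum>k\<le>D. monom (coeff q k) k * taylor_inverse_power (n - 2 - k))" for n
  define b where "b n = (\<Sum>k\<le>D. cmod (coeff q k) * (2 * central_prob (Suc (n - 2 - k))))" for n
  have "(\<lambda>n. central_prob (Suc (n - 2 - k))) \<longlonglongrightarrow> 0" for k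
  proof -
    have "filterlim (\<lambda>n. Suc (n - 2 - k)) sequentially sequentially"
      by (intro filterlim_compose[OF filterlim_Suc] filterlim_compose[OF filterlim_minus_const_nat_at_top[of k]]
          filterlim_minus_const_nat_at_top)
    then show ?thesis by (rule filterlim_compose[OF central_prob_tendsto_0])
  qed
  then have "b \<longlonglongrightarrow> (\<Sum>k\<le>D. cmod (coeff q k) * (2 * 0))"
    unfolding b_def by (intro tendsto_intros)
  then have "b \<longlonglongrightarrow> 0" by simp
  then have "\<forall>\<^sub>F n in sequentially. b n < e" using assms by (rule order_tendstoD)
  with eventually_ge_at_top[of "D + 2"] show ?thesis
  proof eventually_elim
    case (elim n)
    have "degree (V n) \<le> n - 2"
      unfolding V_def
    proof (intro degree_sum_le)
      fix k assume "k \<in> {..D}"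
      then have "degree (monom (coeff q k) k) + degree (taylor_inverse_power (n - 2 - k)) \<le> k + (n - 2 - k)"
        by (intro add_mono degree_monom_le degree_taylor_inverse_power)
      then show "degree (monom (coeff q k) k * taylor_inverse_power (n - 2 - k)) \<le> n - 2"
        using degree_mult_le[of "monom (coeff q k) k" "taylor_inverse_power (n - 2 - k)"]
          \<open>k \<in> {..D}\<close> elim(1) by auto
    qed simp
    moreover have "cmod ((1 + 2 * z) * ((1 + z) * poly q (z * (z + 1)) - (1 + z) ^ n * poly (V n) z)) \<le> e"
      if z: "z \<in> closure petal" for z
    proof -
      define w where "w = z * (z + 1)"
      define A where "A k = approx_one (n - 2 - k) z" for k
      have w: "cmod w \<le> 1" using closure_petalD(2)[OF z] by (simp add: w_def)
      have "(1 + z) ^ n * poly (V n) z = (\<Sum>k\<le>D. coeff q k * w ^ k * (1 + z) * A k)"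
      proof -
        have "(1 + z) ^ n * (coeff q k * z ^ k * poly (taylor_inverse_power (n - 2 - k)) z)
            = coeff q k * w ^ k * (1 + z) * A k" if "k \<le> D" for k
        proof -
          have "n = k + Suc (Suc (n - 2 - k))" using that elim(1) by simp
          then have "(1 + z) ^ n = (1 + z) ^ k * ((1 + z) * (1 + z) ^ Suc (n - 2 - k))"
            by (metis power_add power_Suc)
          then show ?thesis
            unfolding A_def approx_one_def w_def power_mult_distrib
            by (simp only: mult_ac add.commute)
        qed
        then show ?thesis
          unfolding V_def poly_sum sum_distrib_left
          by (intro sum.cong refl) (simp only: poly_mult poly_monom atMost_iff)
      qed
      then have "(1 + 2 * z) * ((1 + z) * poly q w - (1 + z) ^ n * poly (V n) z)
          = (\<Sum>k\<le>D. coeff q k * (w ^ k * (1 + z) * ((1 + 2 * z) * (1 - A k))))"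
        unfolding poly_altdef D_def[symmetric]
        by (simp add: sum_distrib_left sum_subtractf[symmetric] algebra_simps)
      also have "cmod \<dots> \<le> b n"
        unfolding b_def
      proof (intro sum_norm_le)
        fix k
        have "cmod (w ^ k * (1 + z) * ((1 + 2 * z) * (1 - A k)))
            = cmod w ^ k * cmod (1 + z) * cmod ((1 + 2 * z) * (1 - A k))"
          by (simp only: norm_mult norm_power)
        also have "\<dots> \<le> 1 * 2 * central_prob (Suc (n - 2 - k))"
          unfolding A_def using closure_petalD(4)[OF z] w
          by (intro mult_mono approx_one_error[OF z] power_le_one) auto
        finally show "cmod (coeff q k * (w ^ k * (1 + z) * ((1 + 2 * z) * (1 - A k))))
            \<le> cmod (coeff q k) * (2 * central_prob (Suc (n - 2 - k)))"
          by (simp only: norm_mult[of "coeff q k"] mult_1_left) (intro mult_left_mono, auto)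
      qed
      finally show ?thesis using elim(2) by (simp add: w_def)
    qed
    ultimately show ?case by blast
  qed
qed

section \<open>Polynomial approximation in the disc\<close>

text \<open>The function \<open>w \<mapsto> g (r * w)\<close> with \<open>r < 1\<close> is close to \<open>g\<close> on \<open>K\<close> by uniform continuity, and it is
holomorphic in a disc larger than the closed one, so its Taylor polynomials at 0 converge uniformly
on \<open>K\<close>. Continuity of \<open>g\<close> is needed only along the radii from 0 to points of \<open>K\<close>, which lets \<open>g\<close>
be singular at boundary points outside \<open>K\<close>.\<close>

lemma poly_approx_by_dilation:
  fixes g :: "complex \<Rightarrow> complex"
  assumes holo: "g holomorphic_on ball 0 \<rho>" and "0 < \<rho>"
    and K: "compact K" "K \<subseteq> cball 0 \<rho>"
    and cont: "continuous_on ((\<lambda>(r, w). complex_of_real r * w) ` ({0..1} \<times> K)) g"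
    and "0 < e"
  shows "\<exists>q. \<forall>w\<in>K. cmod (g w - poly q w) < e"
proof -
  define T where "T = (\<lambda>(r, w). complex_of_real r * w) ` ({0..1} \<times> K)"
  have "compact T"
    unfolding T_def case_prod_beta
    by (intro compact_continuous_image continuous_intros compact_Times K compact_Icc)
  then have "uniformly_continuous_on T g"
    using cont by (intro compact_uniformly_continuous) (auto simp: T_def)
  then obtain d where d: "0 < d" "\<And>x y. x \<in> T \<Longrightarrow> y \<in> T \<Longrightarrow> dist y x < d \<Longrightarrow> dist (g y) (g x) < e/2"
    using \<open>0 < e\<close> unfolding uniformly_continuous_on_def by (metis half_gt_zero)
  define r where "r = 1 - min (1/2) (d / (2 * \<rho>))"
  have r: "0 \<le> r" "r < 1" "(1 - r) * \<rho> < d"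
  proof -
    show "0 \<le> r" "r < 1" using d(1) \<open>0 < \<rho>\<close> by (auto simp: r_def)
    have "(1 - r) * \<rho> \<le> d / (2 * \<rho>) * \<rho>" using \<open>0 < \<rho>\<close> by (intro mult_right_mono) (auto simp: r_def)
    also have "\<dots> < d" using d(1) \<open>0 < \<rho>\<close> by simp
    finally show "(1 - r) * \<rho> < d" .
  qed
  define a where "a k = (deriv ^^ k) g 0 / fact k" for k
  have sums: "(\<lambda>k. a k * w ^ k) sums g w" if "w \<in> ball 0 \<rho>" for w
    using holomorphic_power_series[OF holo that] by (simp add: a_def)
  have "ereal \<rho> \<le> conv_radius a"
  proof (rule conv_radius_geI_ex')
    fix x assume "0 < x" "ereal x < ereal \<rho>"
    then show "summable (\<lambda>k. a k * of_real x ^ k)"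
      using sums[of "of_real x"] by (auto intro: sums_summable)
  qed
  moreover have "r * \<rho> < \<rho>" using r(2) \<open>0 < \<rho>\<close> by simp
  ultimately have "ereal (r * \<rho>) < conv_radius a"
    by (meson ereal_less_eq(3) less_ereal.simps(1) order_less_le_trans)
  then have "uniform_limit (cball 0 (r * \<rho>)) (\<lambda>n x. \<Sum>i<n. a i * (x - 0) ^ i)
      (\<lambda>x. \<Sum>i. a i * (x - 0) ^ i) sequentially"
    by (rule powser_uniform_limit)
  from uniform_limitD[OF this half_gt_zero[OF \<open>0 < e\<close>]]
  obtain N where "\<forall>n\<ge>N. \<forall>x\<in>cball 0 (r * \<rho>). dist (\<Sum>i<n. a i * (x - 0) ^ i) (\<Sum>i. a i * (x - 0) ^ i) < e/2"
    unfolding eventually_sequentially by blast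
  then have N: "dist (\<Sum>i<N. a i * x ^ i) (\<Sum>i. a i * x ^ i) < e/2" if "x \<in> cball 0 (r * \<rho>)" for x
    using that by simp
  define q where "q = (\<Sum>i<N. monom (a i * of_real r ^ i) i)"
  have "cmod (g w - poly q w) < e" if "w \<in> K" for w
  proof -
    have w: "cmod w \<le> \<rho>" using that K(2) by auto
    define x where "x = of_real r * w"
    have nx: "cmod x \<le> r * \<rho>" using w r(1) by (simp add: x_def norm_mult mult_left_mono)
    then have "x \<in> ball 0 \<rho>" using \<open>r * \<rho> < \<rho>\<close> by simp
    then have "(\<Sum>i. a i * x ^ i) = g x" by (rule sums_unique[OF sums, symmetric])
    moreover have "poly q w = (\<Sum>i<N. a i * x ^ i)"
      by (simp add: q_def poly_sum poly_monom x_def power_mult_distrib mult.assoc)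
    ultimately have 1: "dist (poly q w) (g x) < e/2" using N[of x] nx by simp
    have "w - x = of_real (1 - r) * w" by (simp add: x_def algebra_simps)
    then have "dist w x = (1 - r) * cmod w" using r(2) by (simp only: dist_norm norm_mult norm_of_real)
    also have "\<dots> \<le> (1 - r) * \<rho>" using w r(2) by (intro mult_left_mono) auto
    finally have "dist w x < d" using r(3) by simp
    moreover have "w \<in> T"
      unfolding T_def using that by (intro image_eqI[of _ _ "(1, w)"]) auto
    moreover have "x \<in> T"
      unfolding T_def x_def using that r by (intro image_eqI[of _ _ "(r, w)"]) auto
    ultimately have "dist (g w) (g x) < e/2" by (intro d(2))
    then have "dist (g w) (poly q w) < e" using 1 by (rule dist_triangle_half_l)
    then show ?thesis by (simp add: dist_norm)
  qed
  then show ?thesis by blast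
qed

text \<open>The polynomial \<open>q\<close> approximates \<open>f z / (1 + z)\<close>, transplanted to the disc by \<open>petal_param\<close>. The
radii from 0 to the image of \<open>K\<close> reach the boundary circle only in that image, so continuity of
\<open>f\<close> on the petal and \<open>K\<close> is all that the dilation argument asks for.\<close>

lemma petal_approx_composed_poly:
  assumes holo: "f holomorphic_on petal"
    and K: "compact K" "K \<subseteq> closure petal"
    and cont: "continuous_on (petal \<union> K) f" and "0 < e"
  shows "\<exists>q. \<forall>z\<in>K. cmod (f z - (1 + z) * poly q (z * (z + 1))) < e"
proof -
  define g where "g w = f (petal_param w) / (1 + petal_param w)" for w
  define L where "L = (\<lambda>z. z * (z + 1)) ` K"
  have nz: "1 + z \<noteq> 0" if "z \<in> closure petal" for z
    using closure_petalD(3)[OF that] by auto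
  have "\<exists>q. \<forall>w\<in>L. cmod (g w - poly q w) < e / 2"
  proof (rule poly_approx_by_dilation)
    show "g holomorphic_on ball 0 (1/4)"
    proof -
      have "(f \<circ> petal_param) holomorphic_on ball 0 (1/4)"
        using petal_param_holomorphic holo petal_param_image
        by (intro holomorphic_on_compose_gen) auto
      then show ?thesis
        unfolding g_def o_def
        using petal_param_in_closure nz
        by (intro holomorphic_intros petal_param_holomorphic) auto
    qed
    show "compact L" unfolding L_def using K(1) by (intro compact_continuous_image continuous_intros)
    show L: "L \<subseteq> cball 0 (1/4)" unfolding L_def using K(2) closure_petalD(2) by auto
    define T where "T = (\<lambda>(r, w). complex_of_real r * w) ` ({0..1} \<times> L)"
    have T: "u \<in> cball 0 (1/4) \<and> petal_param u \<in> petal \<union> K" if u: "u \<in> T" for u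
    proof -
      obtain r w where urw: "u = of_real r * w" and r: "0 \<le> r" "r \<le> 1" and w: "w \<in> L"
        using u unfolding T_def by auto
      have cw: "cmod w \<le> 1/4" using L w by auto
      have cu: "cmod u = r * cmod w" using r by (simp add: urw norm_mult)
      show ?thesis
      proof (cases "r = 1")
        case True
        then have "petal_param u \<in> K"
          using w K(2) petal_param_inverse by (auto simp: urw L_def)
        then show ?thesis using True cw by (simp add: urw)
      next
        case False
        then have "cmod u < 1/4"
          using r cw mult_left_mono[OF cw r(1)] unfolding cu by simp
        then show ?thesis using petal_param_in_petal by simp
      qed
    qed
    have "continuous_on T petal_param"
      by (rule continuous_on_subset[OF petal_param_continuous]) (use T in blast)
    moreover from this have "continuous_on T (\<lambda>w. f (petal_param w))"
      by (rule continuous_on_compose2[OF cont]) (use T in blast)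
    moreover have "1 + petal_param w \<noteq> 0" if "w \<in> T" for w
      using T[OF that] petal_param_in_closure nz by blast
    ultimately show "continuous_on ((\<lambda>(r, w). complex_of_real r * w) ` ({0..1} \<times> L)) g"
      unfolding g_def T_def[symmetric] by (intro continuous_intros) auto
  qed (use \<open>0 < e\<close> in auto)
  then obtain q where q: "\<And>w. w \<in> L \<Longrightarrow> cmod (g w - poly q w) < e / 2" by blast
  have "cmod (f z - (1 + z) * poly q (z * (z + 1))) < e" if "z \<in> K" for z
  proof -
    have z: "z \<in> closure petal" using that K(2) by blast
    have "f z - (1 + z) * poly q (z * (z + 1)) = (1 + z) * (g (z * (z + 1)) - poly q (z * (z + 1)))"
      unfolding g_def petal_param_inverse[OF z] using nz[OF z] by (simp add: right_diff_distrib)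
    then have "cmod (f z - (1 + z) * poly q (z * (z + 1)))
        = cmod (1 + z) * cmod (g (z * (z + 1)) - poly q (z * (z + 1)))"
      by (simp only: norm_mult)
    also have "\<dots> \<le> 3/2 * (e / 2)"
      using closure_petalD(4)[OF z] q[of "z * (z + 1)"] that
      by (intro mult_mono) (auto simp: L_def less_imp_le)
    also have "\<dots> < e" using \<open>0 < e\<close> by simp
    finally show ?thesis .
  qed
  then show ?thesis by blast
qed

section \<open>Weighted approximation on the petal\<close>

text \<open>Choosing for every \<open>n\<close> a polynomial whose error is within \<open>1 / (n + 1)\<close> of the infimum merges the
approximations for all \<open>e\<close> into one sequence.\<close>

lemma diagonal_weighted_polynomials:
  assumes "\<And>e. 0 < e \<Longrightarrow> \<forall>\<^sub>F n in sequentially.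
      \<exists>p. degree p \<le> n \<and> (\<forall>z\<in>K. cmod (f z - (1 + z) ^ n * poly p z) \<le> e)"
  shows "\<exists>P :: nat \<Rightarrow> complex poly. (\<forall>n. degree (P n) \<le> n) \<and>
    (\<lambda>n. sup_norm_on K (\<lambda>z. f z - (1 + z) ^ n * poly (P n) z)) \<longlonglongrightarrow> 0"
proof -
  define err where "err n p = sup_norm_on K (\<lambda>z. f z - (1 + z) ^ n * poly p z)" for n p
  define best where "best n = (INF p\<in>{p. degree p \<le> n}. err n p)" for n
  have "\<exists>p. degree p \<le> n \<and> err n p \<le> best n + ennreal (1 / real (Suc n))" for n
  proof (cases "best n = \<infinity>")
    case True
    then show ?thesis by (intro exI[of _ 0]) simp
  next
    case False
    then have "best n < best n + ennreal (1 / real (Suc n))"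
      by (cases "best n")
         (auto simp: ennreal_plus[symmetric] ennreal_less_iff simp del: ennreal_plus of_nat_Suc)
    then obtain p where "degree p \<le> n" "err n p < best n + ennreal (1 / real (Suc n))"
      unfolding best_def by (subst (asm) INF_less_iff) (auto simp del: of_nat_Suc)
    then show ?thesis by (auto intro: less_imp_le)
  qed
  then obtain P where P: "\<And>n. degree (P n) \<le> n" "\<And>n. err n (P n) \<le> best n + ennreal (1 / real (Suc n))"
    by metis
  have "best \<longlonglongrightarrow> 0"
  proof (rule order_tendstoI)
    fix a :: ennreal assume "0 < a"
    then obtain b where b: "0 < b" "b < a" using dense by blast
    then obtain e where e: "b = ennreal e" "0 < e" by (cases b) auto
    from assms[OF e(2)] show "\<forall>\<^sub>F n in sequentially. best n < a"
    proof eventually_elim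
      case (elim n)
      then obtain p where p: "degree p \<le> n" "\<And>z. z \<in> K \<Longrightarrow> cmod (f z - (1 + z) ^ n * poly p z) \<le> e"
        by blast
      have "best n \<le> err n p" unfolding best_def using p(1) by (intro INF_lower) simp
      also have "\<dots> \<le> ennreal e" 
        unfolding err_def sup_norm_on_def using p(2) by (intro SUP_least ennreal_leI)
      finally show ?case using b(2) e(1) by simp
    qed
  qed simp
  moreover have "(\<lambda>n. ennreal (1 / real (Suc n))) \<longlonglongrightarrow> ennreal 0"
    using LIMSEQ_Suc[OF lim_1_over_n] by (intro tendsto_ennrealI) auto
  ultimately have "(\<lambda>n. best n + ennreal (1 / real (Suc n))) \<longlonglongrightarrow> 0 + ennreal 0"
    by (rule tendsto_add)
  then have "(\<lambda>n. err n (P n)) \<longlonglongrightarrow> 0"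
    using tendsto_sandwich[of "\<lambda>_. 0" "\<lambda>n. err n (P n)" sequentially
        "\<lambda>n. best n + ennreal (1 / real (Suc n))" 0] P(2)
    by (simp add: always_eventually del: of_nat_Suc)
  then show ?thesis using P(1) unfolding err_def by blast
qed

theorem theorem3p4:
  fixes G \<Gamma> :: "complex set"
  assumes "lemniscate_loop_around 0 \<Gamma>"
    and "open G" and "connected G" and "bounded G" and "frontier G = \<Gamma>"
  shows
    "(\<forall>f :: complex \<Rightarrow> complex.
        f holomorphic_on G \<and> continuous_on (closure G - {-1/2}) f \<longrightarrow>
        (\<forall>K. compact K \<and> K \<subseteq> closure G - {-1/2} \<longrightarrow>
          (\<exists>P :: nat \<Rightarrow> complex poly. (\<forall>n. degree (P n) \<le> n) \<and>
            (\<lambda>n. sup_norm_on K (\<lambda>z. f z - (1 + z) ^ n * poly (P n) z)) \<longlonglongrightarrow> 0))) \<and>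
     (\<forall>f :: complex \<Rightarrow> complex.
        f holomorphic_on G \<and> continuous_on (closure G) f \<and> f (-1/2) = 0 \<longrightarrow>
          (\<exists>P :: nat \<Rightarrow> complex poly. (\<forall>n. degree (P n) \<le> n) \<and>
            (\<lambda>n. sup_norm_on (closure G) (\<lambda>z. f z - (1 + z) ^ n * poly (P n) z)) \<longlonglongrightarrow> 0))"
proof -
  have G: "G = petal" using assms by (rule domain_bounded_by_loop_eq_petal)
  have node_notin: "- 1 / 2 \<notin> petal" by (simp add: petal_def)
  have part1: "\<exists>P :: nat \<Rightarrow> complex poly. (\<forall>n. degree (P n) \<le> n) \<and>
      (\<lambda>n. sup_norm_on K (\<lambda>z. f z - (1 + z) ^ n * poly (P n) z)) \<longlonglongrightarrow> 0"
    if f: "f holomorphic_on petal" "continuous_on (closure petal - {-1/2}) f"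
      and K: "compact K" "K \<subseteq> closure petal - {-1/2}" for f K
  proof (rule diagonal_weighted_polynomials)
    fix e :: real assume "0 < e"
    \<comment> \<open>\<open>K\<close> keeps a positive distance from the node, so the factor \<open>1 + 2 * z\<close> can be divided out.\<close>
    obtain d where d: "0 < d" "\<And>z. z \<in> K \<Longrightarrow> d \<le> dist (-1/2) z"
      using separate_point_closed[of K "-1/2"] K compact_imp_closed by blast
    have far: "2 * d \<le> cmod (1 + 2 * z)" if "z \<in> K" for z
    proof -
      have "1 + 2 * z = - 2 * (- 1/2 - z)" by simp
      then have "cmod (1 + 2 * z) = 2 * dist (-1/2) z"
        by (simp only: norm_mult dist_norm) simp
      then show ?thesis using d(2)[OF that] by simp
    qed
    have "continuous_on (petal \<union> K) f"
      using f(2) K(2) node_notin closure_subset[of petal] by (rule_tac continuous_on_subset) auto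
    then obtain q where q: "\<And>z. z \<in> K \<Longrightarrow> cmod (f z - (1 + z) * poly q (z * (z + 1))) < e / 2"
      using petal_approx_composed_poly[OF f(1) K(1), of "e / 2"] K(2) \<open>0 < e\<close> by auto
    have "0 < d * e" using d(1) \<open>0 < e\<close> by simp
    from weighted_approx_composed_poly[OF this, of q]
    show "\<forall>\<^sub>F n in sequentially.
      \<exists>p. degree p \<le> n \<and> (\<forall>z\<in>K. cmod (f z - (1 + z) ^ n * poly p z) \<le> e)"
    proof eventually_elim
      case (elim n)
      then obtain V where V: "degree V \<le> n - 2" "\<And>z. z \<in> closure petal \<Longrightarrow>
        cmod ((1 + 2 * z) * ((1 + z) * poly q (z * (z + 1)) - (1 + z) ^ n * poly V z)) \<le> d * e"
        by blast
      have "cmod (f z - (1 + z) ^ n * poly V z) \<le> e" if z: "z \<in> K" for z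
      proof -
        define E where "E = (1 + z) * poly q (z * (z + 1)) - (1 + z) ^ n * poly V z"
        have "2 * d * cmod E \<le> cmod (1 + 2 * z) * cmod E"
          using far[OF z] by (intro mult_right_mono) auto
        also have "\<dots> \<le> d * e" using V(2)[of z] z K(2) by (auto simp: E_def norm_mult)
        finally have "cmod E \<le> e / 2" using d(1) by (simp add: field_simps)
        moreover have "f z - (1 + z) ^ n * poly V z = (f z - (1 + z) * poly q (z * (z + 1))) + E"
          by (simp add: E_def)
        ultimately show ?thesis
          using q[OF z] norm_triangle_ineq[of "f z - (1 + z) * poly q (z * (z + 1))" E]
          by (simp only:)
      qed
      then show ?case using V(1) by (intro exI[of _ V]) auto
    qed
  qed
  have part2: "\<exists>P :: nat \<Rightarrow> complex poly. (\<forall>n. degree (P n) \<le> n) \<and>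
      (\<lambda>n. sup_norm_on (closure petal) (\<lambda>z. f z - (1 + z) ^ n * poly (P n) z)) \<longlonglongrightarrow> 0"
    if f: "f holomorphic_on petal" "continuous_on (closure petal) f" "f (-1/2) = 0" for f
  proof (rule diagonal_weighted_polynomials)
    fix e :: real assume "0 < e"
    have node: "-1/2 \<in> closure petal"
      using petal_param_in_closure[of "-1/4"] petal_param_eq_node_iff[of "-1/4"] by simp
    have "bounded petal" using assms(4) G by simp
    then have "compact (closure petal)" by (simp add: compact_closure)
    moreover have "continuous_on (petal \<union> closure petal) f"
      using f(2) closure_subset[of petal] by (simp add: Un_absorb1)
    \<comment> \<open>The errors below add up to \<open>e/8 + 3/2 * (e/4) + 2/4 * e = e\<close>: the distance of \<open>f\<close> to the polynomial,
      the correction by its value at the node, and the weighted approximation.\<close>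
    ultimately obtain q where q: "\<And>z. z \<in> closure petal \<Longrightarrow>
        cmod (f z - (1 + z) * poly q (z * (z + 1))) < e / 8"
      using petal_approx_composed_poly[OF f(1), of "closure petal" "e / 8"] \<open>0 < e\<close> by auto
    \<comment> \<open>The node corresponds to \<open>w = -1/4\<close>. As \<open>f\<close> vanishes there, \<open>q\<close> is small there, and \<open>q\<close> minus
      its value is divisible by \<open>w + 1/4 = (1 + 2 * z)\<^sup>2 / 4\<close>.\<close>
    define c where "c = poly q (-1/4)"
    have "cmod (1/2 * c) < e / 8" using q[OF node] f(3) by (simp add: c_def)
    then have c: "cmod c < e / 4" by (simp add: norm_mult)
    have "poly (q - [:c:]) (-1/4) = 0" by (simp add: c_def)
    then obtain q1 where "q - [:c:] = [:- (-1/4), 1:] * q1"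
      unfolding poly_eq_0_iff_dvd by (elim dvdE)
    then have "poly (q - [:c:]) w = poly ([:- (-1/4), 1:] * q1) w" for w by simp
    then have q_split: "poly q w = c + (1/4 + w) * poly q1 w" for w
      by (simp add: algebra_simps)
    from weighted_approx_composed_poly[OF \<open>0 < e\<close>, of q1] eventually_ge_at_top[of 2]
    show "\<forall>\<^sub>F n in sequentially.
      \<exists>p. degree p \<le> n \<and> (\<forall>z\<in>closure petal. cmod (f z - (1 + z) ^ n * poly p z) \<le> e)"
    proof eventually_elim
      case (elim n)
      then obtain V where V: "degree V \<le> n - 2" "\<And>z. z \<in> closure petal \<Longrightarrow>
        cmod ((1 + 2 * z) * ((1 + z) * poly q1 (z * (z + 1)) - (1 + z) ^ n * poly V z)) \<le> e"
        by blast
      \<comment> \<open>One factor \<open>1 + 2 * z\<close> of \<open>(1 + 2 * z)\<^sup>2 / 4 = z\<^sup>2 + z + 1/4\<close> controls the error at the node.\<close>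
      define p where "p = [:1/4, 1, 1:] * V"
      have "degree p \<le> degree [:1/4, 1, 1 :: complex:] + degree V"
        unfolding p_def by (rule degree_mult_le)
      then have "degree p \<le> n" using V(1) elim(2) by simp
      moreover have "cmod (f z - (1 + z) ^ n * poly p z) \<le> e" if z: "z \<in> closure petal" for z
      proof -
        define w where "w = z * (z + 1)"
        define E where "E = (1 + 2 * z) * ((1 + z) * poly q1 w - (1 + z) ^ n * poly V z)"
        have p_eq: "poly p z = (1 + 2 * z) / 4 * ((1 + 2 * z) * poly V z)"
          by (simp add: p_def field_simps)
        have w_eq: "1/4 + w = (1 + 2 * z) / 4 * (1 + 2 * z)"
          by (simp add: w_def field_simps)
        have split: "F - N * (s * (t * v)) = (F - a * (c + s * t * u)) + a * c + s * (t * (a * u - N * v))"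
          for F N s t u v a :: complex
          by (simp add: algebra_simps)
        have "f z - (1 + z) ^ n * poly p z
            = (f z - (1 + z) * poly q w) + (1 + z) * c + (1 + 2 * z) / 4 * E"
          unfolding p_eq q_split w_eq E_def by (rule split)
        also have "cmod \<dots> \<le> cmod (f z - (1 + z) * poly q w) + cmod ((1 + z) * c) + cmod ((1 + 2 * z) / 4 * E)"
          by (intro order_trans[OF norm_triangle_ineq] add_mono norm_triangle_ineq order_refl)
        also have "cmod ((1 + z) * c) \<le> 3/2 * (e / 4)"
          unfolding norm_mult using closure_petalD(4)[OF z] c by (intro mult_mono) auto
        also have "cmod ((1 + 2 * z) / 4 * E) \<le> 2/4 * e"
          unfolding norm_mult norm_divide
          using closure_petalD(5)[OF z] V(2)[OF z] by (intro mult_mono divide_right_mono) (auto simp: E_def w_def)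
        also have "cmod (f z - (1 + z) * poly q w) \<le> e / 8"
          using q[OF z] by (simp add: w_def)
        finally show ?thesis by simp
      qed
      ultimately show ?case by blast
    qed
  qed
  show ?thesis using part1 part2 unfolding G by blast
qed

end
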